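(* Let $(x^v,\mu^v)$ be a solution to the relaxed master problem (RMP), let $d^v\in\mathcal D$ be such that $x^v\in\mathcal X_{d^v}$, suppose $Q_{d^v}(x^v)$ is finite and $\mu^v<Q_{d^v}(x^v)$, and let $\mathcal I^v=\{i\in\{1,\dots,n_1\}:x^v_i=1\}$. Then $(x,\mu)=(x^v,\mu^v)$ violates the inequality $$\mu\ge(Q_{d^v}(x^v)-L_{d^v})\Big(\sum_{i\in\mathcal I^v}x_i-\sum_{i\notin\mathcal I^v}x_i\Big)-(Q_{d^v}(x^v)-L_{d^v})(|\mathcal I^v|-1)+L_{d^v}-U(1-\mathbb 1_{d^v}(x)).$$
   Context: Assumption: $\mathcal X=\{0,1\}^{n_1}$. $\mathcal D$ is finite, $(\mathcal X_d)_{d\in\mathcal D}$ is a partition of $\mathcal X$, $\mathbb 1_d:\mathcal X\to\{0,1\}$ is the characteristic function of $\mathcal X_d$, and $c\in\mathbb R^{n_1}$. For each $d\in\mathcal D$, $\mathsf P_d$ is a probability distribution of the random data $\xi=(q,W,T,h)$, and $Q_d(x)=\mathbb E_{\mathsf P_d}[Q(x,\xi)]$, which for a discrete $\mathsf P_d$ with scenarios $s\in\mathcal S_d$, realizations $\xi_{sd}$ and probabilities $\pi_{sd}$ is $\sum_{s\in\mathcal S_d}\pi_{sd}Q(x,\xi_{sd})$. Here $Q(x,\xi)=\min_y\{q^\top y:Wy=h-Tx,\ y\in\mathcal Y\}$ for a given set $\mathcal Y\subseteq\mathbb R^{n_2}$, possibly imposing integrality restrictions ($+\infty$ if infeasible,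 $-\infty$ if unbounded). Assumption on $U$ and $L_d$: $L_d$ ($d\in\mathcal D$) are real numbers with $L_d\le\min_{x\in\mathcal X}Q_d(x)$, and $U$ is a constant with $\infty>U\ge\max_{d\in\mathcal D}L_d-\min_{d\in\mathcal D}L_d$. (RMP): given finite sets $\underline{\mathcal F_d},\underline{\mathcal O_d}$ of real-valued functions on $\mathcal X$ ($d\in\mathcal D$), minimize $c^\top x+\mu$ over $x\in\mathcal X$, $\mu\in\mathbb R$ subject to, for every $d\in\mathcal D$: if $x\in\mathcal X_d$ then $f(x)\le0$ for all $f\in\underline{\mathcal F_d}$ and $o(x)\le\mu$ for all $o\in\underline{\mathcal O_d}$. A "solution" to (RMP) is a feasible point. *)

theory Defs
  imports "HOL-Probability.Probability"
begin

type_synonym ('n1, 'n2, 'm) data =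
  "(real ^ 'n2) \<times> (real ^ 'n2 ^ 'm) \<times> (real ^ 'n1 ^ 'm) \<times> (real ^ 'm)"

definition binary_vectors :: "(real ^ 'n) set" where
  "binary_vectors = {x. \<forall>i. x $ i \<in> {0, 1}}"

lemma finite_binary_vectors: "finite (binary_vectors :: (real ^ 'n) set)"
proof -
  have "binary_vectors \<subseteq> vec_lambda ` (PiE (UNIV :: 'n set) (\<lambda>_. {0, 1 :: real}))"
  proof
    fix x :: "real ^ 'n" assume "x \<in> binary_vectors"
    then have "vec_nth x \<in> PiE UNIV (\<lambda>_. {0, 1})"
      by (auto simp: binary_vectors_def PiE_def Pi_def)
    then show "x \<in> vec_lambda ` (PiE (UNIV :: 'n set) (\<lambda>_. {0, 1 :: real}))"
      by (metis image_eqI vec_nth_inverse)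
  qed
  moreover have "finite (PiE (UNIV :: 'n set) (\<lambda>_. {0, 1 :: real}))"
    by (intro finite_PiE) auto
  ultimately show ?thesis
    by (meson finite_imageI finite_subset)
qed

text \<open>A partition indexed by \<^term>\<open>D\<close>. Cells are allowed to be empty.\<close>

definition indexed_partition :: "'d set \<Rightarrow> ('d \<Rightarrow> 'a set) \<Rightarrow> 'a set \<Rightarrow> bool" where
  "indexed_partition D Xd A \<longleftrightarrow> disjoint_family_on Xd D \<and> (\<Union>d\<in>D. Xd d) = A"

text \<open>The optimal value of the second stage. The infimum is taken in the extended reals, so it is
  \<open>\<infinity>\<close> for an infeasible and \<open>-\<infinity>\<close> for an unbounded problem.\<close>

definition recourse ::
  "(real ^ 'n2) set \<Rightarrow> real ^ 'n1 \<Rightarrow> ('n1, 'n2, 'm :: finite) data \<Rightarrow> ereal" where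
  "recourse Y x \<xi> = (case \<xi> of (q, W, T, h) \<Rightarrow>
     (INF y \<in> {y \<in> Y. W *v y = h - T *v x}. ereal (q \<bullet> y)))"

text \<open>Expectation of an extended real function as the difference of the integrals of its positive
  and negative parts. As \<open>\<infinity> - \<infinity> = \<infinity>\<close> in \<^typ>\<open>ereal\<close>, the value is finite only if
  both parts have a finite integral.\<close>

definition ereal_expectation :: "'a measure \<Rightarrow> ('a \<Rightarrow> ereal) \<Rightarrow> ereal" where
  "ereal_expectation M f =
     enn2ereal (\<integral>\<^sup>+ \<omega>. e2ennreal (f \<omega>) \<partial>M) - enn2ereal (\<integral>\<^sup>+ \<omega>. e2ennreal (- f \<omega>) \<partial>M)"

text \<open>No measurability of the integrand is required, so for a discrete distribution the expectation
  is the weighted sum over its scenarios.\<close>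

lemma ereal_expectation_discrete:
  fixes f :: "'a \<Rightarrow> ereal"
  assumes S: "finite S" and p: "\<And>s. s \<in> S \<Longrightarrow> 0 \<le> p s"
    and M: "\<And>A. A \<in> sets M \<Longrightarrow> emeasure M A = (\<Sum>s\<in>S. ennreal (p s) * indicator A (r s))"
    and singletons: "\<And>s. s \<in> S \<Longrightarrow> {r s} \<in> sets M"
  shows "ereal_expectation M f = (\<Sum>s\<in>S. ereal (p s) * f (r s))"
proof -
  have fin: "finite (r ` S)" using S by simp
  have rS: "r ` S \<in> sets M"
    using sets.countable[of "r ` S" M] fin singletons by (auto intro: countable_finite)
  have "emeasure M (space M - r ` S) = 0"
    using M[of "space M - r ` S"] rS by (auto intro!: sum.neutral)
  then have AE: "AE x in M. x \<in> r ` S"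
    by (intro AE_I[of _ _ "space M - r ` S"]) (use rS in auto)
  have int: "(\<integral>\<^sup>+ x. g x \<partial>M) = (\<Sum>s\<in>S. ennreal (p s) * g (r s))" for g :: "'a \<Rightarrow> ennreal"
  proof -
    have "(\<integral>\<^sup>+ x. g x \<partial>M) = (\<integral>\<^sup>+ x. g x * indicator (r ` S) x \<partial>M)"
      by (intro nn_integral_cong_AE) (use AE in auto)
    also have "\<dots> = (\<Sum>x\<in>r ` S. g x * emeasure M {x})"
      using fin singletons by (intro nn_integral_indicator_finite) auto
    also have "\<dots> = (\<Sum>x\<in>r ` S. \<Sum>s\<in>S. ennreal (p s) * (g x * indicator {x} (r s)))"
      using M singletons by (intro sum.cong refl) (auto simp: sum_distrib_left mult_ac)
    also have "\<dots> = (\<Sum>s\<in>S. \<Sum>x\<in>r ` S. ennreal (p s) * (g x * indicator {x} (r s)))"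
      by (rule sum.swap)
    also have "\<dots> = (\<Sum>s\<in>S. ennreal (p s) * g (r s))"
    proof (intro sum.cong refl)
      fix s assume s: "s \<in> S"
      have "(\<Sum>x\<in>r ` S. ennreal (p s) * (g x * indicator {x} (r s))) =
            (\<Sum>x\<in>r ` S. if x = r s then ennreal (p s) * g x else 0)"
        by (intro sum.cong refl) (auto simp: indicator_def)
      also have "\<dots> = ennreal (p s) * g (r s)"
        using fin s by (subst sum.delta) auto
      finally show "(\<Sum>x\<in>r ` S. ennreal (p s) * (g x * indicator {x} (r s))) =
        ennreal (p s) * g (r s)" .
    qed
    finally show ?thesis .
  qed
  have split: "enn2ereal (\<Sum>s\<in>S. ennreal (p s) * e2ennreal (f (r s))) -
      enn2ereal (\<Sum>s\<in>S. ennreal (p s) * e2ennreal (- f (r s))) =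
      (\<Sum>s\<in>S. ereal (p s) * f (r s))"
    using S p
  proof (induction S rule: finite_induct)
    case empty
    then show ?case by (simp add: zero_ennreal.rep_eq)
  next
    case (insert s S)
    have add: "(b + a) - (d + c) = (b - d) + (a - c)"
      if "0 \<le> a" "0 \<le> b" "0 \<le> c" "0 \<le> d" for a b c d :: ereal
      using that by (cases a; cases b; cases c; cases d) auto
    have ps: "0 \<le> p s" using insert by simp
    have one: "enn2ereal (ennreal (p s) * e2ennreal (f (r s))) -
        enn2ereal (ennreal (p s) * e2ennreal (- f (r s))) = ereal (p s) * f (r s)"
    proof -
      have "enn2ereal (ennreal (p s) * e2ennreal z) = ereal (p s) * max 0 z" for z
        using ps by (simp add: times_ennreal.rep_eq max_def enn2ereal_ennreal
            enn2ereal_e2ennreal e2ennreal_neg zero_ennreal.rep_eq)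
      note eq = this
      show ?thesis unfolding eq using ps
        by (cases "f (r s)"; cases "p s = 0") (auto simp: max_def zero_ereal_def)
    qed
    show ?case
      using insert.IH insert.hyps insert.prems
      by (simp add: plus_ennreal.rep_eq add one)
  qed
  show ?thesis
    unfolding ereal_expectation_def int using split .
qed

definition expected_recourse ::
  "(real ^ 'n2) set \<Rightarrow> ('n1, 'n2, 'm :: finite) data measure \<Rightarrow> real ^ 'n1 \<Rightarrow> ereal" where
  "expected_recourse Y P x = ereal_expectation P (recourse Y x)"

text \<open>A minimization problem is given by its objective function and its feasible set.\<close>

type_synonym 'z minimization = "('z \<Rightarrow> real) \<times> 'z set"

definition is_feasible :: "'z minimization \<Rightarrow> 'z \<Rightarrow> bool" where
  "is_feasible p z \<longleftrightarrow> z \<in> snd p"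

definition RMP ::
  "real ^ 'n1 \<Rightarrow> 'd set \<Rightarrow> ('d \<Rightarrow> (real ^ 'n1) set) \<Rightarrow>
   ('d \<Rightarrow> (real ^ 'n1 \<Rightarrow> real) set) \<Rightarrow> ('d \<Rightarrow> (real ^ 'n1 \<Rightarrow> real) set) \<Rightarrow>
   ((real ^ 'n1) \<times> real) minimization" where
  "RMP c D Xd Fs Os =
     ((\<lambda>(x, \<mu>). c \<bullet> x + \<mu>),
      {(x, \<mu>). x \<in> binary_vectors \<and>
        (\<forall>d\<in>D. x \<in> Xd d \<longrightarrow> (\<forall>f\<in>Fs d. f x \<le> 0) \<and> (\<forall>g\<in>Os d. g x \<le> \<mu>))})"

end

theory Submission imports Defs begin

text \<open>
  The cut is the classical integer L-shaped optimality cut, switched off outside the cell of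
  \<open>d\<^sub>v\<close> by the term with \<open>U\<close>. The map sending a binary \<open>x\<close> to
  \<open>(\<Sum>i\<in>I\<^sub>v. x $ i) - (\<Sum>i\<in>- I\<^sub>v. x $ i)\<close> attains its maximum \<open>card I\<^sub>v\<close> exactly at the
  indicator vector of \<open>I\<^sub>v\<close>, that is, at \<open>x\<^sub>v\<close>. There the factor of \<open>Q\<^sub>v - L d\<^sub>v\<close> is \<open>1\<close>, so the
  lower bound \<open>L d\<^sub>v\<close> cancels, and the term with \<open>U\<close> vanishes because \<open>x\<^sub>v\<close> lies in the cell.
  Thus the right-hand side of the cut equals \<open>Q\<^sub>v\<close>, which exceeds \<open>\<mu>\<^sub>v\<close>.
\<close>

lemma binary_vector_sum_support:
  assumes "x \<in> binary_vectors"
  shows "(\<Sum>i\<in>{i. x $ i = 1}. x $ i) - (\<Sum>i\<in>- {i. x $ i = 1}. x $ i) = real (card {i. x $ i = 1})"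
proof -
  have "(\<Sum>i\<in>- {i. x $ i = 1}. x $ i) = 0"
    using assms by (intro sum.neutral) (auto simp: binary_vectors_def)
  then show ?thesis by simp
qed

theorem theorem10:
  fixes D :: "'d set"
    and Xd :: "'d \<Rightarrow> (real ^ 'n1) set"
    and c :: "real ^ 'n1"
    and Y :: "(real ^ 'n2) set"
    and P :: "'d \<Rightarrow> ('n1, 'n2, 'm :: finite) data measure"
    and L :: "'d \<Rightarrow> real"
    and U :: real
    and Fs Os :: "'d \<Rightarrow> (real ^ 'n1 \<Rightarrow> real) set"
    and x x\<^sub>v :: "real ^ 'n1"
    and \<mu> \<mu>\<^sub>v :: real
    and d\<^sub>v :: 'd
    and I\<^sub>v :: "'n1 set"
  assumes "finite D"
    and "indexed_partition D Xd binary_vectors"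
    and "\<And>d. d \<in> D \<Longrightarrow> prob_space (P d)"
    and "\<And>d. d \<in> D \<Longrightarrow> sets (P d) = sets borel"
    and "\<And>d. d \<in> D \<Longrightarrow> ereal (L d) \<le> Min (expected_recourse Y (P d) ` binary_vectors)"
    and "U \<ge> Max (L ` D) - Min (L ` D)"
    and "\<And>d. d \<in> D \<Longrightarrow> finite (Fs d)"
    and "\<And>d. d \<in> D \<Longrightarrow> finite (Os d)"
    and "is_feasible (RMP c D Xd Fs Os) (x\<^sub>v, \<mu>\<^sub>v)"
    and "d\<^sub>v \<in> D"
    and "x\<^sub>v \<in> Xd d\<^sub>v"
    and "\<bar>expected_recourse Y (P d\<^sub>v) x\<^sub>v\<bar> \<noteq> \<infinity>"
    and "ereal \<mu>\<^sub>v < expected_recourse Y (P d\<^sub>v) x\<^sub>v"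
    and "I\<^sub>v = {i. x\<^sub>v $ i = 1}"
    and "(x, \<mu>) = (x\<^sub>v, \<mu>\<^sub>v)"
  shows "let Q\<^sub>v = real_of_ereal (expected_recourse Y (P d\<^sub>v) x\<^sub>v) in
    \<not> (\<mu> \<ge> (Q\<^sub>v - L d\<^sub>v) * ((\<Sum>i\<in>I\<^sub>v. x $ i) - (\<Sum>i\<in>- I\<^sub>v. x $ i))
           - (Q\<^sub>v - L d\<^sub>v) * (real (card I\<^sub>v) - 1) + L d\<^sub>v
           - U * (1 - indicator (Xd d\<^sub>v) x))"
proof -
  define Q where "Q = real_of_ereal (expected_recourse Y (P d\<^sub>v) x\<^sub>v)"
  have point: "x = x\<^sub>v" "\<mu> = \<mu>\<^sub>v" using assms(15) by simp_all
  have "ereal Q = expected_recourse Y (P d\<^sub>v) x\<^sub>v"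
    using assms(12) by (simp add: Q_def ereal_real)
  then have less: "\<mu>\<^sub>v < Q" using assms(13) by (metis less_ereal.simps(1))
  have "x\<^sub>v \<in> binary_vectors" using assms(9) by (simp add: is_feasible_def RMP_def)
  note support = binary_vector_sum_support[OF this, folded assms(14)]
  have "(Q - L d\<^sub>v) * ((\<Sum>i\<in>I\<^sub>v. x $ i) - (\<Sum>i\<in>- I\<^sub>v. x $ i))
           - (Q - L d\<^sub>v) * (real (card I\<^sub>v) - 1) + L d\<^sub>v
           - U * (1 - indicator (Xd d\<^sub>v) x) = Q"
    unfolding point support using assms(11) by (simp add: algebra_simps)
  then show ?thesis
    unfolding Let_def Q_def[symmetric] using less point by simp
qed

end
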